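(* $\mathbf{LV}$ is the logic preserving degrees of truth of the variety of $\mathsf V$-algebras.
   Context: $\mathbf{LV}$ is the smallest finitary consequence relation in the language $\{\land,\lor,\to,\mathbin{\Box\!\!\rightarrow},0,1\}$ containing classical propositional axioms and (L1) $\varphi\mathbin{\Box\!\!\rightarrow}\varphi$, (L2) $((\varphi\mathbin{\Box\!\!\rightarrow}\psi)\wedge(\psi\mathbin{\Box\!\!\rightarrow}\varphi))\to((\varphi\mathbin{\Box\!\!\rightarrow}\gamma)\leftrightarrow(\psi\mathbin{\Box\!\!\rightarrow}\gamma))$, (L3) $((\varphi\vee\psi)\mathbin{\Box\!\!\rightarrow}\varphi)\vee((\varphi\vee\psi)\mathbin{\Box\!\!\rightarrow}\psi)\vee(((\varphi\vee\psi)\mathbin{\Box\!\!\rightarrow}\gamma)\leftrightarrow((\varphi\mathbin{\Box\!\!\rightarrow}\gamma)\wedge(\psi\mathbin{\Box\!\!\rightarrow}\gamma)))$, (L4) $(\varphi\mathbin{\Box\!\!\rightarrow}(\psi\land\gamma))\leftrightarrow((\varphi\mathbin{\Box\!\!\rightarrow}\psi)\land(\varphi\mathbin{\Box\!\!\rightarrow}\gamma))$, closed under modus ponens and the weak rule: if $\vdash\varphi\to\psi$ then $\vdash(\gamma\mathbin{\Box\!\!\rightarrow}\varphi)\to(\gamma\mathbin{\Box\!\!\rightarrow}\psi)$. A $\mathsf V$-algebra is a Boolean algebra with a binary operation $\mathbin{\Box\!\!\rightarrow}$ satisfying the equational translations $\varphi\approx 1$ of (L1)–(L3) (with (L2) as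 $((x\mathbin{\Box\!\!\rightarrow}y)\wedge(y\mathbin{\Box\!\!\rightarrow}x))\le((x\mathbin{\Box\!\!\rightarrow}z)\leftrightarrow(y\mathbin{\Box\!\!\rightarrow}z))$) and $x\mathbin{\Box\!\!\rightarrow}(y\wedge z)=(x\mathbin{\Box\!\!\rightarrow}y)\wedge(x\mathbin{\Box\!\!\rightarrow}z)$. The logic preserving degrees of truth of a class $\mathsf K$ of ordered algebras is: $\Gamma\vdash^{\le}_{\mathsf K}\varphi$ iff for all $\mathbf A\in\mathsf K$, assignments $h$ and $a\in A$, if $a\le h(\gamma)$ for every $\gamma\in\Gamma$ then $a\le h(\varphi)$. *)

theory Defs
  imports Main
begin

section \<open>Formulas\<close>

datatype fm =
    Var nat
  | Bot (\<open>\<^bold>0\<close>)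
  | Top (\<open>\<^bold>1\<close>)
  | And fm fm (infixl \<open>\<^bold>\<and>\<close> 67)
  | Or fm fm (infixl \<open>\<^bold>\<or>\<close> 66)
  | Imp fm fm (infixr \<open>\<^bold>\<rightarrow>\<close> 65)
  | Cond fm fm (infix \<open>\<^bold>\<box>\<^bold>\<rightarrow>\<close> 68)

abbreviation Iff :: "fm \<Rightarrow> fm \<Rightarrow> fm" (infix \<open>\<^bold>\<leftrightarrow>\<close> 65) where
  "p \<^bold>\<leftrightarrow> q \<equiv> (p \<^bold>\<rightarrow> q) \<^bold>\<and> (q \<^bold>\<rightarrow> p)"

primrec subst :: "(nat \<Rightarrow> fm) \<Rightarrow> fm \<Rightarrow> fm" where
  "subst s (Var n) = s n"
| "subst s \<^bold>0 = \<^bold>0"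
| "subst s \<^bold>1 = \<^bold>1"
| "subst s (p \<^bold>\<and> q) = subst s p \<^bold>\<and> subst s q"
| "subst s (p \<^bold>\<or> q) = subst s p \<^bold>\<or> subst s q"
| "subst s (p \<^bold>\<rightarrow> q) = subst s p \<^bold>\<rightarrow> subst s q"
| "subst s (p \<^bold>\<box>\<^bold>\<rightarrow> q) = subst s p \<^bold>\<box>\<^bold>\<rightarrow> subst s q"


section \<open>The logic LV\<close>

type_synonym consequence = "fm set \<Rightarrow> fm \<Rightarrow> bool"

text \<open>As usual in abstract algebraic logic, a consequence relation is required to be
  invariant under substitutions.\<close>

definition consequence_relation :: "consequence \<Rightarrow> bool" where
  "consequence_relation R \<longleftrightarrow>
     (\<forall>\<Gamma> p. p \<in> \<Gamma> \<longrightarrow> R \<Gamma> p) \<and>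
     (\<forall>\<Gamma> \<Delta> p. R \<Gamma> p \<longrightarrow> \<Gamma> \<subseteq> \<Delta> \<longrightarrow> R \<Delta> p) \<and>
     (\<forall>\<Gamma> \<Delta> p. (\<forall>q\<in>\<Delta>. R \<Gamma> q) \<longrightarrow> R \<Delta> p \<longrightarrow> R \<Gamma> p) \<and>
     (\<forall>\<Gamma> p s. R \<Gamma> p \<longrightarrow> R (subst s ` \<Gamma>) (subst s p))"

definition finitary :: "consequence \<Rightarrow> bool" where
  "finitary R \<longleftrightarrow> (\<forall>\<Gamma> p. R \<Gamma> p \<longrightarrow> (\<exists>\<Delta>. finite \<Delta> \<and> \<Delta> \<subseteq> \<Gamma> \<and> R \<Delta> p))"

text \<open>A Hilbert-style axiomatisation of classical logic over modus ponens; the negation of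
  \<open>p\<close> is \<open>p \<^bold>\<rightarrow> \<^bold>0\<close>.\<close>

inductive classical_axiom :: "fm \<Rightarrow> bool" where
  "classical_axiom (p \<^bold>\<rightarrow> q \<^bold>\<rightarrow> p)"
| "classical_axiom ((p \<^bold>\<rightarrow> q \<^bold>\<rightarrow> r) \<^bold>\<rightarrow> (p \<^bold>\<rightarrow> q) \<^bold>\<rightarrow> p \<^bold>\<rightarrow> r)"
| "classical_axiom (p \<^bold>\<and> q \<^bold>\<rightarrow> p)"
| "classical_axiom (p \<^bold>\<and> q \<^bold>\<rightarrow> q)"
| "classical_axiom (p \<^bold>\<rightarrow> q \<^bold>\<rightarrow> p \<^bold>\<and> q)"
| "classical_axiom (p \<^bold>\<rightarrow> p \<^bold>\<or> q)"
| "classical_axiom (q \<^bold>\<rightarrow> p \<^bold>\<or> q)"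
| "classical_axiom ((p \<^bold>\<rightarrow> r) \<^bold>\<rightarrow> (q \<^bold>\<rightarrow> r) \<^bold>\<rightarrow> p \<^bold>\<or> q \<^bold>\<rightarrow> r)"
| "classical_axiom (\<^bold>0 \<^bold>\<rightarrow> p)"
| "classical_axiom \<^bold>1"
| "classical_axiom (((p \<^bold>\<rightarrow> \<^bold>0) \<^bold>\<rightarrow> \<^bold>0) \<^bold>\<rightarrow> p)"

inductive conditional_axiom :: "fm \<Rightarrow> bool" where
  L1: "conditional_axiom (p \<^bold>\<box>\<^bold>\<rightarrow> p)"
| L2: "conditional_axiom
         ((p \<^bold>\<box>\<^bold>\<rightarrow> q) \<^bold>\<and> (q \<^bold>\<box>\<^bold>\<rightarrow> p) \<^bold>\<rightarrow> ((p \<^bold>\<box>\<^bold>\<rightarrow> r) \<^bold>\<leftrightarrow> (q \<^bold>\<box>\<^bold>\<rightarrow> r)))"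
| L3: "conditional_axiom
         (((p \<^bold>\<or> q) \<^bold>\<box>\<^bold>\<rightarrow> p) \<^bold>\<or> ((p \<^bold>\<or> q) \<^bold>\<box>\<^bold>\<rightarrow> q) \<^bold>\<or>
          (((p \<^bold>\<or> q) \<^bold>\<box>\<^bold>\<rightarrow> r) \<^bold>\<leftrightarrow> (p \<^bold>\<box>\<^bold>\<rightarrow> r) \<^bold>\<and> (q \<^bold>\<box>\<^bold>\<rightarrow> r)))"
| L4: "conditional_axiom
         ((p \<^bold>\<box>\<^bold>\<rightarrow> (q \<^bold>\<and> r)) \<^bold>\<leftrightarrow> (p \<^bold>\<box>\<^bold>\<rightarrow> q) \<^bold>\<and> (p \<^bold>\<box>\<^bold>\<rightarrow> r))"

text \<open>The last clause is the weak rule: it applies to theorems only, whereas modus ponens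
  applies under arbitrary premises.\<close>

definition LV_closed :: "consequence \<Rightarrow> bool" where
  "LV_closed R \<longleftrightarrow>
     (\<forall>p. classical_axiom p \<or> conditional_axiom p \<longrightarrow> R {} p) \<and>
     (\<forall>p q. R {p, p \<^bold>\<rightarrow> q} q) \<and>
     (\<forall>p q r. R {} (p \<^bold>\<rightarrow> q) \<longrightarrow> R {} ((r \<^bold>\<box>\<^bold>\<rightarrow> p) \<^bold>\<rightarrow> (r \<^bold>\<box>\<^bold>\<rightarrow> q)))"

definition LV :: consequence where
  "LV = (LEAST R. consequence_relation R \<and> finitary R \<and> LV_closed R)"


section \<open>V-algebras\<close>

record 'a cond_algebra =
  carrier :: "'a set"
  falsum :: 'a (\<open>\<zero>\<index>\<close>)
  verum :: 'a (\<open>\<one>\<index>\<close>)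
  meet :: "'a \<Rightarrow> 'a \<Rightarrow> 'a" (infixl \<open>\<sqinter>\<index>\<close> 67)
  join :: "'a \<Rightarrow> 'a \<Rightarrow> 'a" (infixl \<open>\<squnion>\<index>\<close> 66)
  impl :: "'a \<Rightarrow> 'a \<Rightarrow> 'a" (infixr \<open>\<rightarrow>\<index>\<close> 65)
  condl :: "'a \<Rightarrow> 'a \<Rightarrow> 'a" (infix \<open>\<box>\<rightarrow>\<index>\<close> 68)

definition bicond :: "'a cond_algebra \<Rightarrow> 'a \<Rightarrow> 'a \<Rightarrow> 'a" (infix \<open>\<leftrightarrow>\<index>\<close> 65) where
  "x \<leftrightarrow>\<^bsub>A\<^esub> y = (x \<rightarrow>\<^bsub>A\<^esub> y) \<sqinter>\<^bsub>A\<^esub> (y \<rightarrow>\<^bsub>A\<^esub> x)"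

definition leq :: "'a cond_algebra \<Rightarrow> 'a \<Rightarrow> 'a \<Rightarrow> bool" (infix \<open>\<sqsubseteq>\<index>\<close> 50) where
  "x \<sqsubseteq>\<^bsub>A\<^esub> y \<longleftrightarrow> x \<sqinter>\<^bsub>A\<^esub> y = x"

text \<open>Complemented distributive lattices, where the complement of \<open>x\<close> is \<open>x \<rightarrow> \<zero>\<close> since
  implication, not negation, is a primitive operation.\<close>

locale boolean_cond_algebra =
  fixes A :: "'a cond_algebra" (structure)
  assumes falsum_closed: "\<zero> \<in> carrier A"
    and verum_closed: "\<one> \<in> carrier A"
    and meet_closed: "\<lbrakk>x \<in> carrier A; y \<in> carrier A\<rbrakk> \<Longrightarrow> x \<sqinter> y \<in> carrier A"
    and join_closed: "\<lbrakk>x \<in> carrier A; y \<in> carrier A\<rbrakk> \<Longrightarrow> x \<squnion> y \<in> carrier A"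
    and impl_closed: "\<lbrakk>x \<in> carrier A; y \<in> carrier A\<rbrakk> \<Longrightarrow> x \<rightarrow> y \<in> carrier A"
    and condl_closed: "\<lbrakk>x \<in> carrier A; y \<in> carrier A\<rbrakk> \<Longrightarrow> x \<box>\<rightarrow> y \<in> carrier A"
    and meet_assoc: "\<lbrakk>x \<in> carrier A; y \<in> carrier A; z \<in> carrier A\<rbrakk> \<Longrightarrow>
           (x \<sqinter> y) \<sqinter> z = x \<sqinter> (y \<sqinter> z)"
    and join_assoc: "\<lbrakk>x \<in> carrier A; y \<in> carrier A; z \<in> carrier A\<rbrakk> \<Longrightarrow>
           (x \<squnion> y) \<squnion> z = x \<squnion> (y \<squnion> z)"
    and meet_comm: "\<lbrakk>x \<in> carrier A; y \<in> carrier A\<rbrakk> \<Longrightarrow> x \<sqinter> y = y \<sqinter> x"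
    and join_comm: "\<lbrakk>x \<in> carrier A; y \<in> carrier A\<rbrakk> \<Longrightarrow> x \<squnion> y = y \<squnion> x"
    and meet_join_absorb: "\<lbrakk>x \<in> carrier A; y \<in> carrier A\<rbrakk> \<Longrightarrow> x \<sqinter> (x \<squnion> y) = x"
    and join_meet_absorb: "\<lbrakk>x \<in> carrier A; y \<in> carrier A\<rbrakk> \<Longrightarrow> x \<squnion> (x \<sqinter> y) = x"
    and meet_join_distrib: "\<lbrakk>x \<in> carrier A; y \<in> carrier A; z \<in> carrier A\<rbrakk> \<Longrightarrow>
           x \<sqinter> (y \<squnion> z) = (x \<sqinter> y) \<squnion> (x \<sqinter> z)"
    and join_falsum: "x \<in> carrier A \<Longrightarrow> x \<squnion> \<zero> = x"
    and meet_verum: "x \<in> carrier A \<Longrightarrow> x \<sqinter> \<one> = x"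
    and meet_compl: "x \<in> carrier A \<Longrightarrow> x \<sqinter> (x \<rightarrow> \<zero>) = \<zero>"
    and join_compl: "x \<in> carrier A \<Longrightarrow> x \<squnion> (x \<rightarrow> \<zero>) = \<one>"
    and impl_eq: "\<lbrakk>x \<in> carrier A; y \<in> carrier A\<rbrakk> \<Longrightarrow> x \<rightarrow> y = (x \<rightarrow> \<zero>) \<squnion> y"

locale V_algebra = boolean_cond_algebra +
  assumes V1: "x \<in> carrier A \<Longrightarrow> x \<box>\<rightarrow> x = \<one>"
    and V2: "\<lbrakk>x \<in> carrier A; y \<in> carrier A; z \<in> carrier A\<rbrakk> \<Longrightarrow>
           (x \<box>\<rightarrow> y) \<sqinter> (y \<box>\<rightarrow> x) \<sqsubseteq> ((x \<box>\<rightarrow> z) \<leftrightarrow> (y \<box>\<rightarrow> z))"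
    and V3: "\<lbrakk>x \<in> carrier A; y \<in> carrier A; z \<in> carrier A\<rbrakk> \<Longrightarrow>
           ((x \<squnion> y) \<box>\<rightarrow> x) \<squnion> ((x \<squnion> y) \<box>\<rightarrow> y) \<squnion>
           (((x \<squnion> y) \<box>\<rightarrow> z) \<leftrightarrow> (x \<box>\<rightarrow> z) \<sqinter> (y \<box>\<rightarrow> z)) = \<one>"
    and V4: "\<lbrakk>x \<in> carrier A; y \<in> carrier A; z \<in> carrier A\<rbrakk> \<Longrightarrow>
           x \<box>\<rightarrow> (y \<sqinter> z) = (x \<box>\<rightarrow> y) \<sqinter> (x \<box>\<rightarrow> z)"


section \<open>The logic preserving degrees of truth\<close>

primrec eval :: "'a cond_algebra \<Rightarrow> (nat \<Rightarrow> 'a) \<Rightarrow> fm \<Rightarrow> 'a" where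
  "eval A h (Var n) = h n"
| "eval A h \<^bold>0 = \<zero>\<^bsub>A\<^esub>"
| "eval A h \<^bold>1 = \<one>\<^bsub>A\<^esub>"
| "eval A h (p \<^bold>\<and> q) = eval A h p \<sqinter>\<^bsub>A\<^esub> eval A h q"
| "eval A h (p \<^bold>\<or> q) = eval A h p \<squnion>\<^bsub>A\<^esub> eval A h q"
| "eval A h (p \<^bold>\<rightarrow> q) = eval A h p \<rightarrow>\<^bsub>A\<^esub> eval A h q"
| "eval A h (p \<^bold>\<box>\<^bold>\<rightarrow> q) = eval A h p \<box>\<rightarrow>\<^bsub>A\<^esub> eval A h q"

definition degrees_of_truth :: "'a cond_algebra set \<Rightarrow> consequence" where
  "degrees_of_truth K \<Gamma> p \<longleftrightarrow>
     (\<forall>A\<in>K. \<forall>h. range h \<subseteq> carrier A \<longrightarrow>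
        (\<forall>a\<in>carrier A. (\<forall>q\<in>\<Gamma>. a \<sqsubseteq>\<^bsub>A\<^esub> eval A h q) \<longrightarrow> a \<sqsubseteq>\<^bsub>A\<^esub> eval A h p))"

text \<open>The class of all V-algebras is not a set of any one type, so it is represented, for each
  type \<open>'a\<close>, by the algebras whose carrier is a subset of \<open>'a\<close>. If \<open>'a\<close> is infinite, every
  finite or countable V-algebra has an isomorphic copy among these.\<close>

definition V_algebras :: "'a cond_algebra set" where
  "V_algebras = {A. V_algebra A}"

end

(*
  LV is the relation "p follows by modus ponens from theorems and premises".  Soundness is a direct
  induction.  For completeness with possibly infinitely many premises, a lower bound of the premises
  need not exist in the Lindenbaum algebra of theorems, so one is adjoined: shift all variables to
  free Var 0, and take the Lindenbaum algebra of the global logic with the additional axioms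
  Var 0 -> g, for g a (shifted) premise.  If Var 0 lies below the shifted conclusion there, a
  derivation of this uses finitely many premises; substituting their conjunction for Var 0 and
  shifting back turns the additional axioms into theorems, so the conjunction implies the conclusion.
*)
theory Submission
  imports Defs "HOL-Library.Countable"
begin

section \<open>Derivability\<close>

text \<open>In contrast to \<^emph>\<open>local\<close> derivability below, the weak rule applies here to consequences of \<open>X\<close>.\<close>

inductive global_der :: "fm set \<Rightarrow> fm \<Rightarrow> bool" for X where
  global_classical: "classical_axiom p \<Longrightarrow> global_der X p"
| global_conditional: "conditional_axiom p \<Longrightarrow> global_der X p"
| global_premise: "p \<in> X \<Longrightarrow> global_der X p"
| global_mp: "global_der X p \<Longrightarrow> global_der X (p \<^bold>\<rightarrow> q) \<Longrightarrow> global_der X q"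
| global_weak: "global_der X (p \<^bold>\<rightarrow> q) \<Longrightarrow> global_der X ((r \<^bold>\<box>\<^bold>\<rightarrow> p) \<^bold>\<rightarrow> (r \<^bold>\<box>\<^bold>\<rightarrow> q))"

inductive local_der :: "fm set \<Rightarrow> fm \<Rightarrow> bool" for \<Gamma> where
  local_premise: "p \<in> \<Gamma> \<Longrightarrow> local_der \<Gamma> p"
| local_theorem: "global_der {} p \<Longrightarrow> local_der \<Gamma> p"
| local_mp: "local_der \<Gamma> p \<Longrightarrow> local_der \<Gamma> (p \<^bold>\<rightarrow> q) \<Longrightarrow> local_der \<Gamma> q"

section \<open>Structural properties of the two derivability relations\<close>

lemma classical_axiom_subst: "classical_axiom p \<Longrightarrow> classical_axiom (subst s p)"
  by (induction rule: classical_axiom.induct) (auto intro: classical_axiom.intros)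

lemma conditional_axiom_subst: "conditional_axiom p \<Longrightarrow> conditional_axiom (subst s p)"
  by (induction rule: conditional_axiom.induct) (auto intro: conditional_axiom.intros)

text \<open>Allowing \<open>Y\<close> to differ from the image of \<open>X\<close> lets a
  substitution discharge axioms: once their instances are theorems, \<open>Y\<close> can be
  empty.\<close>

lemma global_der_subst:
  assumes "global_der X p" "\<And>x. x \<in> X \<Longrightarrow> global_der Y (subst s x)"
  shows "global_der Y (subst s p)"
  using assms
  by (induction rule: global_der.induct)
    (auto intro: global_der.intros classical_axiom_subst conditional_axiom_subst)

lemma global_der_mono: "global_der X p \<Longrightarrow> X \<subseteq> Y \<Longrightarrow> global_der Y p"
  by (induction rule: global_der.induct) (auto intro: global_der.intros)

lemma global_der_finite:
  assumes "global_der X p"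
  shows "\<exists>Y. finite Y \<and> Y \<subseteq> X \<and> global_der Y p"
  using assms
proof (induction rule: global_der.induct)
  case (global_premise p)
  then show ?case
    by (intro exI[of _ "{p}"]) (auto intro: global_der.intros)
next
  case (global_mp p q)
  then obtain Y Z where "finite Y" "Y \<subseteq> X" "global_der Y p"
      "finite Z" "Z \<subseteq> X" "global_der Z (p \<^bold>\<rightarrow> q)"
    by blast
  then show ?case
    by (intro exI[of _ "Y \<union> Z"])
      (auto intro: global_der.global_mp[of _ p] global_der_mono)
qed (blast intro: global_der.intros)+

lemma local_der_mono: "local_der \<Gamma> p \<Longrightarrow> \<Gamma> \<subseteq> \<Delta> \<Longrightarrow> local_der \<Delta> p"
  by (induction rule: local_der.induct) (auto intro: local_der.intros)

lemma local_der_cut: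
  "local_der \<Delta> p \<Longrightarrow> (\<And>q. q \<in> \<Delta> \<Longrightarrow> local_der \<Gamma> q) \<Longrightarrow> local_der \<Gamma> p"
  by (induction rule: local_der.induct) (auto intro: local_der.intros)

lemma local_der_subst: "local_der \<Gamma> p \<Longrightarrow> local_der (subst s ` \<Gamma>) (subst s p)"
  by (induction rule: local_der.induct)
    (auto intro: local_der.intros global_der_subst)

lemma local_der_empty: "local_der {} p \<longleftrightarrow> global_der {} p"
proof
  show "local_der {} p \<Longrightarrow> global_der {} p"
    by (induction rule: local_der.induct) (auto intro: global_mp)
qed (rule local_theorem)

lemma local_der_finite:
  assumes "local_der \<Gamma> p"
  shows "\<exists>\<Delta>. finite \<Delta> \<and> \<Delta> \<subseteq> \<Gamma> \<and> local_der \<Delta> p"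
  using assms
proof (induction rule: local_der.induct)
  case (local_premise p)
  then show ?case
    by (intro exI[of _ "{p}"]) (auto intro: local_der.intros)
next
  case (local_theorem p)
  then show ?case
    by (blast intro: local_der.intros)
next
  case (local_mp p q)
  then obtain \<Delta> \<Theta> where "finite \<Delta>" "\<Delta> \<subseteq> \<Gamma>" "local_der \<Delta> p"
      "finite \<Theta>" "\<Theta> \<subseteq> \<Gamma>" "local_der \<Theta> (p \<^bold>\<rightarrow> q)"
    by blast
  then show ?case
    by (intro exI[of _ "\<Delta> \<union> \<Theta>"])
      (auto intro: local_der.local_mp[of _ p] local_der_mono)
qed

text \<open>\<open>local_der\<close> has all the required closure properties, and induction on
  derivations places it below every relation that has them, in the pointwise order used by
  \<open>LEAST\<close>.\<close>

lemma LV_eq_local_der: "LV = local_der"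
  unfolding LV_def
proof (rule Least_equality)
  have "LV_closed local_der"
    unfolding LV_closed_def local_der_empty
    by (auto intro: global_der.intros local_mp[of _ p for p] local_premise)
  moreover have "consequence_relation local_der"
    unfolding consequence_relation_def
    by (blast intro: local_premise local_der_mono local_der_cut local_der_subst)
  moreover have "finitary local_der"
    unfolding finitary_def using local_der_finite by blast
  ultimately show "consequence_relation local_der \<and> finitary local_der \<and> LV_closed local_der"
    by blast
next
  fix R assume "consequence_relation R \<and> finitary R \<and> LV_closed R"
  then have R: "consequence_relation R" and "LV_closed R"
    by auto
  note prem = R[unfolded consequence_relation_def, THEN conjunct1, rule_format]
    and mono = R[unfolded consequence_relation_def, THEN conjunct2, THEN conjunct1, rule_format]
    and cut = R[unfolded consequence_relation_def, THEN conjunct2, THEN conjunct2, THEN conjunct1,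
      rule_format]
  have ax: "\<And>p. classical_axiom p \<or> conditional_axiom p \<Longrightarrow> R {} p"
    and mp0: "\<And>p q. R {p, p \<^bold>\<rightarrow> q} q"
    and weak: "\<And>p q r. R {} (p \<^bold>\<rightarrow> q) \<Longrightarrow> R {} ((r \<^bold>\<box>\<^bold>\<rightarrow> p) \<^bold>\<rightarrow> (r \<^bold>\<box>\<^bold>\<rightarrow> q))"
    using \<open>LV_closed R\<close> by (auto simp: LV_closed_def)
  \<comment> \<open>The closure condition gives modus ponens only from the two-element premise set;
    cut transfers it to an arbitrary \<open>\<Gamma>\<close>.\<close>
  have mp: "R \<Gamma> q" if "R \<Gamma> p" "R \<Gamma> (p \<^bold>\<rightarrow> q)" for \<Gamma> p q
    using that by (auto intro: cut[OF _ mp0])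
  have theorems: "R {} p" if "global_der {} p" for p
    using that by (induction rule: global_der.induct) (auto intro: ax mp weak)
  have "R \<Gamma> p" if "local_der \<Gamma> p" for \<Gamma> p
    using that by (induction rule: local_der.induct) (auto intro: prem mp mono[OF theorems])
  then show "local_der \<le> R"
    by auto
qed


section \<open>Soundness\<close>

context boolean_cond_algebra
begin

section \<open>Lattice order and residuation in Boolean algebras\<close>

lemmas closed = falsum_closed verum_closed meet_closed join_closed impl_closed condl_closed

lemma eval_closed: "range h \<subseteq> carrier A \<Longrightarrow> eval A h p \<in> carrier A"
  by (induction p) (auto intro: closed)

text \<open>Absorption applied to the join of \<open>x\<close> with \<open>\<zero>\<close>, which is
  \<open>x\<close> itself.\<close>

lemma meet_idem: "x \<in> carrier A \<Longrightarrow> x \<sqinter> x = x"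
  by (metis join_falsum meet_join_absorb falsum_closed)

lemma leq_refl: "x \<in> carrier A \<Longrightarrow> x \<sqsubseteq> x"
  by (simp add: leq_def meet_idem)

lemma leq_trans:
  "x \<sqsubseteq> y \<Longrightarrow> y \<sqsubseteq> z \<Longrightarrow> x \<in> carrier A \<Longrightarrow> y \<in> carrier A \<Longrightarrow> z \<in> carrier A \<Longrightarrow> x \<sqsubseteq> z"
  unfolding leq_def by (metis meet_assoc)

lemma leq_antisym: "x \<sqsubseteq> y \<Longrightarrow> y \<sqsubseteq> x \<Longrightarrow> x \<in> carrier A \<Longrightarrow> y \<in> carrier A \<Longrightarrow> x = y"
  unfolding leq_def by (metis meet_comm)

lemma leq_verum: "x \<in> carrier A \<Longrightarrow> x \<sqsubseteq> \<one>"
  by (simp add: leq_def meet_verum)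

lemma verum_leq_iff: "x \<in> carrier A \<Longrightarrow> \<one> \<sqsubseteq> x \<longleftrightarrow> x = \<one>"
  using leq_antisym leq_verum leq_refl verum_closed by blast

lemma meet_leq1: "x \<in> carrier A \<Longrightarrow> y \<in> carrier A \<Longrightarrow> x \<sqinter> y \<sqsubseteq> x"
  unfolding leq_def by (metis meet_assoc meet_comm meet_idem)

lemma meet_leq2: "x \<in> carrier A \<Longrightarrow> y \<in> carrier A \<Longrightarrow> x \<sqinter> y \<sqsubseteq> y"
  by (metis meet_comm meet_leq1)

lemma leq_meetI:
  "x \<sqsubseteq> y \<Longrightarrow> x \<sqsubseteq> z \<Longrightarrow> x \<in> carrier A \<Longrightarrow> y \<in> carrier A \<Longrightarrow> z \<in> carrier A \<Longrightarrow> x \<sqsubseteq> y \<sqinter> z"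
  unfolding leq_def by (metis meet_assoc)

lemma leq_join1: "x \<in> carrier A \<Longrightarrow> y \<in> carrier A \<Longrightarrow> x \<sqsubseteq> x \<squnion> y"
  by (simp add: leq_def meet_join_absorb)

lemma leq_join2: "x \<in> carrier A \<Longrightarrow> y \<in> carrier A \<Longrightarrow> y \<sqsubseteq> x \<squnion> y"
  by (metis join_comm leq_join1)

lemma falsum_leq: "x \<in> carrier A \<Longrightarrow> \<zero> \<sqsubseteq> x"
  by (metis join_falsum join_comm leq_join1 falsum_closed)

lemma join_leqI:
  assumes "x \<sqsubseteq> z" "y \<sqsubseteq> z" and c: "x \<in> carrier A" "y \<in> carrier A" "z \<in> carrier A"
  shows "x \<squnion> y \<sqsubseteq> z"
proof -
  have "z \<sqinter> (x \<squnion> y) = x \<squnion> y"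
    using assms by (simp add: leq_def meet_join_distrib meet_comm)
  then show ?thesis
    using c by (simp add: leq_def closed meet_comm)
qed

text \<open>Residuation, from left to right by distributing the meet with \<open>y\<close> over the
  material form of the implication, from right to left by excluded middle. It reduces the classical
  axioms to inequalities.\<close>

lemma leq_impl_iff:
  assumes c: "x \<in> carrier A" "y \<in> carrier A" "z \<in> carrier A"
  shows "x \<sqsubseteq> y \<rightarrow> z \<longleftrightarrow> x \<sqinter> y \<sqsubseteq> z"
proof
  have mono: "x \<sqinter> y \<sqsubseteq> (y \<rightarrow> z) \<sqinter> y" if "x \<sqsubseteq> y \<rightarrow> z"
    using that c by (meson closed leq_meetI leq_trans meet_leq1 meet_leq2)
  have "(y \<rightarrow> z) \<sqinter> y = y \<sqinter> z"
    using c
    by (metis impl_eq impl_closed falsum_closed meet_comm meet_join_distrib meet_compl join_comm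
        join_falsum meet_closed)
  then show "x \<sqsubseteq> y \<rightarrow> z \<Longrightarrow> x \<sqinter> y \<sqsubseteq> z"
    using mono c by (metis meet_closed meet_leq2 leq_trans)
next
  assume le: "x \<sqinter> y \<sqsubseteq> z"
  \<comment> \<open>Split \<open>x\<close> into its part inside \<open>y\<close>, which lies below
    \<open>z\<close>, and its part inside the complement of \<open>y\<close>.\<close>
  have "x = x \<sqinter> (y \<squnion> (y \<rightarrow> \<zero>))"
    using c by (simp add: join_compl meet_verum)
  also have "\<dots> = (x \<sqinter> y) \<squnion> (x \<sqinter> (y \<rightarrow> \<zero>))"
    using c by (simp add: meet_join_distrib closed)
  also have "\<dots> \<sqsubseteq> (y \<rightarrow> \<zero>) \<squnion> z"
    using c by (intro join_leqI leq_trans[OF le leq_join2] leq_trans[OF meet_leq2 leq_join1])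
      (simp_all add: closed)
  finally show "x \<sqsubseteq> y \<rightarrow> z"
    using c by (simp add: impl_eq[of y z])
qed

lemma impl_eq_verum_iff: "x \<in> carrier A \<Longrightarrow> y \<in> carrier A \<Longrightarrow> x \<rightarrow> y = \<one> \<longleftrightarrow> x \<sqsubseteq> y"
  by (metis impl_closed leq_impl_iff meet_comm meet_verum verum_closed verum_leq_iff)

lemma bicond_refl: "x \<in> carrier A \<Longrightarrow> x \<leftrightarrow> x = \<one>"
  using impl_eq_verum_iff[of x x] by (simp add: bicond_def leq_refl meet_idem verum_closed)

lemma meet_impl_leq: "x \<in> carrier A \<Longrightarrow> y \<in> carrier A \<Longrightarrow> (x \<rightarrow> y) \<sqinter> x \<sqsubseteq> y"
  using leq_impl_iff leq_refl impl_closed by blast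

text \<open>Modus ponens at an arbitrary degree \<open>a\<close>, the form needed for premises that
  need not have value \<open>\<one>\<close>.\<close>

lemma mp_leq:
  assumes "a \<sqsubseteq> x" "a \<sqsubseteq> x \<rightarrow> y" "a \<in> carrier A" "x \<in> carrier A" "y \<in> carrier A"
  shows "a \<sqsubseteq> y"
  using assms by (meson leq_meetI leq_trans meet_impl_leq meet_closed impl_closed)

lemma eval_classical_axiom:
  assumes "classical_axiom p" and h: "range h \<subseteq> carrier A"
  shows "eval A h p = \<one>"
  using assms(1)
proof cases
  case (1 p q)
  then show ?thesis
    using eval_closed[OF h] by (simp add: impl_eq_verum_iff leq_impl_iff meet_leq1 closed)
next
  case (2 p q r)
  define x y z where "x = eval A h p" "y = eval A h q" "z = eval A h r"
  note xyz = this
  have c: "x \<in> carrier A" "y \<in> carrier A" "z \<in> carrier A"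
    using eval_closed[OF h] by (auto simp: xyz)
  let ?a = "(x \<rightarrow> y \<rightarrow> z) \<sqinter> (x \<rightarrow> y) \<sqinter> x"
  have a: "?a \<sqsubseteq> x" "?a \<sqsubseteq> x \<rightarrow> y" "?a \<sqsubseteq> x \<rightarrow> y \<rightarrow> z"
    using c by (meson closed leq_trans meet_leq1 meet_leq2)+
  have "?a \<sqsubseteq> z"
    using c by (intro mp_leq[of ?a y z] mp_leq[OF a(1,2)] mp_leq[OF a(1,3)]) (simp_all add: closed)
  then show ?thesis
    using c 2 by (simp add: impl_eq_verum_iff leq_impl_iff closed xyz[symmetric])
next
  case (8 p r q)
  define x y z where "x = eval A h p" "y = eval A h q" "z = eval A h r"
  note xyz = this
  have c: "x \<in> carrier A" "y \<in> carrier A" "z \<in> carrier A"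
    using eval_closed[OF h] by (auto simp: xyz)
  let ?b = "(x \<rightarrow> z) \<sqinter> (y \<rightarrow> z)"
  have "?b \<sqinter> x \<sqsubseteq> z" "?b \<sqinter> y \<sqsubseteq> z"
    using c meet_leq1[of "x \<rightarrow> z" "y \<rightarrow> z"] meet_leq2[of "x \<rightarrow> z" "y \<rightarrow> z"]
    by (simp_all add: leq_impl_iff[symmetric] closed)
  then have "?b \<sqinter> (x \<squnion> y) \<sqsubseteq> z"
    using c by (simp add: meet_join_distrib closed join_leqI)
  then show ?thesis
    using c 8 by (simp add: impl_eq_verum_iff leq_impl_iff closed xyz[symmetric])
next
  case (11 p)
  define x where "x = eval A h p"
  have c: "x \<in> carrier A"
    using eval_closed[OF h] by (auto simp: x_def)
  \<comment> \<open>The second factor equals \<open>\<one>\<close>. Distributing over it leaves a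
    part below \<open>x\<close> and a part below \<open>\<zero>\<close>.\<close>
  have "((x \<rightarrow> \<zero>) \<rightarrow> \<zero>) \<sqinter> (x \<squnion> (x \<rightarrow> \<zero>)) \<sqsubseteq> x"
    using c by (subst meet_join_distrib)
      (auto intro!: closed join_leqI meet_leq2 leq_trans[OF meet_impl_leq falsum_leq])
  then show ?thesis
    using c 11 by (simp add: join_compl meet_verum impl_eq_verum_iff closed x_def[symmetric])
qed (use eval_closed[OF h] in \<open>simp_all add: impl_eq_verum_iff leq_impl_iff leq_refl falsum_leq
    meet_leq1 meet_leq2 leq_join1 leq_join2 closed\<close>)

end

context V_algebra
begin

section \<open>Validity of the conditional axioms and of derivations\<close>

lemma eval_conditional_axiom:
  assumes "conditional_axiom p" and h: "range h \<subseteq> carrier A"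
  shows "eval A h p = \<one>"
  using assms(1)
proof cases
  \<comment> \<open>\<open>V4\<close> is an equation, so both sides of this biconditional have the
    same value.\<close>
  case (L4 p q r)
  then show ?thesis
    using eval_closed[OF h] by (simp add: V4 bicond_refl[unfolded bicond_def] closed)
qed (use eval_closed[OF h] in \<open>simp_all add: V1 V2[unfolded bicond_def] V3[unfolded bicond_def]
    impl_eq_verum_iff closed\<close>)

text \<open>\<open>V4\<close> turns the meet equation defining the first inequality into the one
  defining the second. This is the algebraic content of the weak rule.\<close>

lemma condl_mono:
  assumes "x \<sqsubseteq> y" "x \<in> carrier A" "y \<in> carrier A" "z \<in> carrier A"
  shows "z \<box>\<rightarrow> x \<sqsubseteq> z \<box>\<rightarrow> y"
  using assms V4[of z x y] by (simp add: leq_def)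

lemma eval_theorem: "global_der {} p \<Longrightarrow> range h \<subseteq> carrier A \<Longrightarrow> eval A h p = \<one>"
proof (induction rule: global_der.induct)
  case (global_mp p q)
  then show ?case
    using eval_closed impl_eq_verum_iff[of \<one> "eval A h q"] by (simp add: verum_leq_iff verum_closed)
next
  case (global_weak p q r)
  then show ?case
    using eval_closed by (simp add: impl_eq_verum_iff condl_mono closed)
qed (simp_all add: eval_classical_axiom eval_conditional_axiom)

text \<open>Theorems have value \<open>\<one>\<close> and so lie above every \<open>a\<close>; modus
  ponens keeps the lower bound by \<open>mp_leq\<close>.\<close>

lemma local_der_sound:
  assumes "local_der \<Gamma> p" "range h \<subseteq> carrier A" "a \<in> carrier A" "\<And>q. q \<in> \<Gamma> \<Longrightarrow> a \<sqsubseteq> eval A h q"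
  shows "a \<sqsubseteq> eval A h p"
  using assms(1)
proof (induction rule: local_der.induct)
  case (local_mp p q)
  then show ?case
    using mp_leq[of a "eval A h p" "eval A h q"] assms(2,3) eval_closed by simp
qed (use assms in \<open>simp_all add: eval_theorem leq_verum\<close>)

end


section \<open>The Lindenbaum preorder\<close>

text \<open>The weak rule rules out a deduction theorem for \<open>global_der\<close>, so
  hypothetical reasoning is done with derivable implications; they form the preorder whose quotient
  is the Lindenbaum algebra.\<close>

abbreviation entails :: "fm set \<Rightarrow> fm \<Rightarrow> fm \<Rightarrow> bool" where
  "entails X p q \<equiv> global_der X (p \<^bold>\<rightarrow> q)"

context
  fixes X :: "fm set"
begin

section \<open>Classical propositional calculus over a fixed set of additional axioms\<close>

lemma weaken: "global_der X q \<Longrightarrow> entails X p q"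
  by (blast intro: global_mp global_classical classical_axiom.intros)

lemma entails_mp: "entails X p (q \<^bold>\<rightarrow> r) \<Longrightarrow> entails X p q \<Longrightarrow> entails X p r"
  by (blast intro: global_mp global_classical classical_axiom.intros)

lemma entails_refl: "entails X p p"
  using entails_mp[of p "p \<^bold>\<rightarrow> p" p] by (blast intro: global_classical classical_axiom.intros)

lemma entails_trans: "entails X p q \<Longrightarrow> entails X q r \<Longrightarrow> entails X p r"
  by (blast intro: entails_mp weaken)

lemma entails_and1: "entails X (p \<^bold>\<and> q) p"
  and entails_and2: "entails X (p \<^bold>\<and> q) q"
  and entails_or1: "entails X p (p \<^bold>\<or> q)"
  and entails_or2: "entails X q (p \<^bold>\<or> q)"
  and entails_bot: "entails X \<^bold>0 p"
  by (blast intro: global_classical classical_axiom.intros)+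

lemma entails_top: "entails X p \<^bold>1"
  by (blast intro: weaken global_classical classical_axiom.intros)

lemma entails_andI:
  assumes "entails X p q" "entails X p r"
  shows "entails X p (q \<^bold>\<and> r)"
proof -
  have "entails X p (q \<^bold>\<rightarrow> r \<^bold>\<rightarrow> q \<^bold>\<and> r)"
    by (blast intro: weaken global_classical classical_axiom.intros)
  then show ?thesis
    using assms entails_mp by blast
qed

lemma entails_orI: "entails X p r \<Longrightarrow> entails X q r \<Longrightarrow> entails X (p \<^bold>\<or> q) r"
  by (blast intro: global_mp global_classical classical_axiom.intros)

text \<open>Syntactic residuation, replacing the deduction theorem. From right to left,
  \<open>q\<close> is paired with the antecedent \<open>p\<close> and the given implication is
  composed under both.\<close>

lemma entails_imp_iff: "entails X p (q \<^bold>\<rightarrow> r) \<longleftrightarrow> entails X (p \<^bold>\<and> q) r"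
proof
  show "entails X p (q \<^bold>\<rightarrow> r) \<Longrightarrow> entails X (p \<^bold>\<and> q) r"
    by (meson entails_and1 entails_and2 entails_mp entails_trans)
next
  assume "entails X (p \<^bold>\<and> q) r"
  then have "entails X p (q \<^bold>\<rightarrow> p \<^bold>\<and> q \<^bold>\<rightarrow> r)"
    by (blast intro: weaken)
  moreover have "entails X p (q \<^bold>\<rightarrow> p \<^bold>\<and> q)"
    by (blast intro: global_classical classical_axiom.intros)
  moreover have "entails X p ((q \<^bold>\<rightarrow> p \<^bold>\<and> q \<^bold>\<rightarrow> r) \<^bold>\<rightarrow> (q \<^bold>\<rightarrow> p \<^bold>\<and> q) \<^bold>\<rightarrow> q \<^bold>\<rightarrow> r)"
    by (blast intro: weaken global_classical classical_axiom.intros)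
  ultimately show "entails X p (q \<^bold>\<rightarrow> r)"
    by (blast intro: entails_mp)
qed

lemma entails_and_imp_bot: "entails X (p \<^bold>\<and> (p \<^bold>\<rightarrow> \<^bold>0)) q"
  by (meson entails_and1 entails_and2 entails_bot entails_mp entails_trans)

lemma entails_dne: "entails X ((p \<^bold>\<rightarrow> \<^bold>0) \<^bold>\<rightarrow> \<^bold>0) p"
  by (blast intro: global_classical classical_axiom.intros)

lemma excluded_middle: "entails X q (p \<^bold>\<or> (p \<^bold>\<rightarrow> \<^bold>0))"
proof -
  \<comment> \<open>The negated disjunction refutes \<open>p\<close>, hence yields the second
    disjunct and a contradiction; double negation elimination finishes.\<close>
  let ?n = "(p \<^bold>\<or> (p \<^bold>\<rightarrow> \<^bold>0)) \<^bold>\<rightarrow> \<^bold>0"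
  have "entails X ?n (p \<^bold>\<rightarrow> \<^bold>0)"
    unfolding entails_imp_iff
    by (meson entails_and1 entails_and2 entails_mp entails_or1 entails_trans)
  then have "entails X ?n \<^bold>0"
    by (meson entails_mp entails_or2 entails_refl entails_trans)
  then show ?thesis
    by (meson entails_dne global_mp weaken)
qed

text \<open>Residuating \<open>p\<close> to the right leaves the disjunction alone as antecedent,
  where case distinction applies.\<close>

lemma entails_and_or: "entails X (p \<^bold>\<and> (q \<^bold>\<or> r)) ((p \<^bold>\<and> q) \<^bold>\<or> (p \<^bold>\<and> r))"
proof -
  have comm: "entails X (s \<^bold>\<and> t) (t \<^bold>\<and> s)" for s t
    by (blast intro: entails_andI entails_and1 entails_and2)
  have "entails X (q \<^bold>\<or> r) (p \<^bold>\<rightarrow> (p \<^bold>\<and> q) \<^bold>\<or> (p \<^bold>\<and> r))"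
    by (meson comm entails_imp_iff entails_orI entails_or1 entails_or2 entails_trans)
  then show ?thesis
    by (meson comm entails_imp_iff entails_trans)
qed

lemma entails_material: "entails X (p \<^bold>\<rightarrow> q) ((p \<^bold>\<rightarrow> \<^bold>0) \<^bold>\<or> q)"
proof -
  have "entails X (p \<^bold>\<or> (p \<^bold>\<rightarrow> \<^bold>0)) ((p \<^bold>\<rightarrow> q) \<^bold>\<rightarrow> (p \<^bold>\<rightarrow> \<^bold>0) \<^bold>\<or> q)"
    unfolding entails_imp_iff[symmetric]
  proof (rule entails_orI)
    show "entails X p ((p \<^bold>\<rightarrow> q) \<^bold>\<rightarrow> (p \<^bold>\<rightarrow> \<^bold>0) \<^bold>\<or> q)"
      unfolding entails_imp_iff
      by (meson entails_and1 entails_and2 entails_mp entails_or2 entails_trans)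
    show "entails X (p \<^bold>\<rightarrow> \<^bold>0) ((p \<^bold>\<rightarrow> q) \<^bold>\<rightarrow> (p \<^bold>\<rightarrow> \<^bold>0) \<^bold>\<or> q)"
      unfolding entails_imp_iff
      by (meson entails_and1 entails_or1 entails_trans)
  qed
  then show ?thesis
    by (meson excluded_middle global_mp entails_refl)
qed

lemma material_entails: "entails X ((p \<^bold>\<rightarrow> \<^bold>0) \<^bold>\<or> q) (p \<^bold>\<rightarrow> q)"
proof (rule entails_orI)
  show "entails X (p \<^bold>\<rightarrow> \<^bold>0) (p \<^bold>\<rightarrow> q)"
    unfolding entails_imp_iff
    by (meson entails_and1 entails_and2 entails_bot entails_mp entails_trans)
  show "entails X q (p \<^bold>\<rightarrow> q)"
    unfolding entails_imp_iff by (rule entails_and1)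
qed

section \<open>Interderivability as a congruence\<close>

definition equivalent :: "fm \<Rightarrow> fm \<Rightarrow> bool" where
  "equivalent p q \<longleftrightarrow> entails X p q \<and> entails X q p"

lemma equivalentI: "entails X p q \<Longrightarrow> entails X q p \<Longrightarrow> equivalent p q"
  by (simp add: equivalent_def)

lemma equivalent_top_iff: "equivalent p \<^bold>1 \<longleftrightarrow> global_der X p"
  unfolding equivalent_def
  by (metis entails_top weaken global_mp global_classical classical_axiom.intros(10))

lemma equivalent_and_iff: "equivalent (p \<^bold>\<and> q) p \<longleftrightarrow> entails X p q"
  unfolding equivalent_def
  by (meson entails_and1 entails_and2 entails_andI entails_refl entails_trans)

lemma equivalent_and:
  "equivalent p p' \<Longrightarrow> equivalent q q' \<Longrightarrow> equivalent (p \<^bold>\<and> q) (p' \<^bold>\<and> q')"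
  unfolding equivalent_def
  by (meson entails_and1 entails_and2 entails_andI entails_trans)

lemma equivalent_or:
  "equivalent p p' \<Longrightarrow> equivalent q q' \<Longrightarrow> equivalent (p \<^bold>\<or> q) (p' \<^bold>\<or> q')"
  unfolding equivalent_def
  by (meson entails_or1 entails_or2 entails_orI entails_trans)

lemma equivalent_imp:
  assumes "equivalent p p'" "equivalent q q'"
  shows "equivalent (p \<^bold>\<rightarrow> q) (p' \<^bold>\<rightarrow> q')"
proof -
  have "entails X (p \<^bold>\<rightarrow> q) (p' \<^bold>\<rightarrow> q')" if "entails X p' p" "entails X q q'" for p p' q q'
    unfolding entails_imp_iff using that
    by (meson entails_and1 entails_and2 entails_mp entails_trans)
  then show ?thesis
    using assms unfolding equivalent_def by blast
qed

text \<open>The weak rule applied to \<open>L1\<close> yields the conditionals between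
  \<open>p\<close> and \<open>q\<close> in both directions, and \<open>L2\<close> then exchanges the
  antecedents. The weak rule must apply to consequences of \<open>X\<close> here, which is why the
  Lindenbaum algebra uses the global logic.\<close>

lemma entails_cond_left:
  assumes "entails X p q" "entails X q p"
  shows "entails X (p \<^bold>\<box>\<^bold>\<rightarrow> r) (q \<^bold>\<box>\<^bold>\<rightarrow> r)"
proof -
  have "global_der X (p \<^bold>\<box>\<^bold>\<rightarrow> q)" "global_der X (q \<^bold>\<box>\<^bold>\<rightarrow> p)"
    using assms by (meson L1 global_conditional global_mp global_weak)+
  then have "global_der X ((p \<^bold>\<box>\<^bold>\<rightarrow> q) \<^bold>\<and> (q \<^bold>\<box>\<^bold>\<rightarrow> p))"
    by (blast intro: global_mp global_classical classical_axiom.intros)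
  then show ?thesis
    by (meson L2 entails_and1 global_conditional global_mp)
qed

lemma equivalent_cond:
  "equivalent p p' \<Longrightarrow> equivalent q q' \<Longrightarrow> equivalent (p \<^bold>\<box>\<^bold>\<rightarrow> q) (p' \<^bold>\<box>\<^bold>\<rightarrow> q')"
  unfolding equivalent_def by (meson entails_cond_left entails_trans global_weak)

lemmas equivalent_congs =
  equivalent_and equivalent_or equivalent_imp equivalent_cond

end


section \<open>The Lindenbaum algebra inside an infinite type\<close>

instance fm :: countable
  by countable_datatype

text \<open>\<open>c\<close> plays the role of the quotient map: the elements of its range code the
  equivalence classes inside the prescribed type.\<close>

locale lindenbaum =
  fixes X :: "fm set" and c :: "fm \<Rightarrow> 'a"
  assumes c_eq_iff: "c p = c q \<longleftrightarrow> equivalent X p q"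
begin

text \<open>Outside \<open>range c\<close> the choice is unspecified, which is harmless because the
  carrier of \<open>alg\<close> is exactly that range.\<close>

definition rep :: "'a \<Rightarrow> fm" where
  "rep x = (SOME p. c p = x)"

definition alg :: "'a cond_algebra" where
  "alg = \<lparr>carrier = range c, falsum = c \<^bold>0, verum = c \<^bold>1,
     meet = (\<lambda>x y. c (rep x \<^bold>\<and> rep y)), join = (\<lambda>x y. c (rep x \<^bold>\<or> rep y)),
     impl = (\<lambda>x y. c (rep x \<^bold>\<rightarrow> rep y)), condl = (\<lambda>x y. c (rep x \<^bold>\<box>\<^bold>\<rightarrow> rep y))\<rparr>"

lemma equivalent_rep: "equivalent X (rep (c p)) p"
  unfolding c_eq_iff[symmetric] rep_def by (rule someI) (rule refl)

text \<open>The congruence properties make the operations independent of the representatives chosen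
  by \<open>rep\<close>.\<close>

lemma alg_simps [simp]:
  "carrier alg = range c"
  "falsum alg = c \<^bold>0"
  "verum alg = c \<^bold>1"
  "meet alg (c p) (c q) = c (p \<^bold>\<and> q)"
  "join alg (c p) (c q) = c (p \<^bold>\<or> q)"
  "impl alg (c p) (c q) = c (p \<^bold>\<rightarrow> q)"
  "condl alg (c p) (c q) = c (p \<^bold>\<box>\<^bold>\<rightarrow> q)"
  by (simp_all add: alg_def c_eq_iff equivalent_congs equivalent_rep)

lemma bicond_alg [simp]: "bicond alg (c p) (c q) = c (p \<^bold>\<leftrightarrow> q)"
  by (simp add: bicond_def)

lemma leq_alg [simp]: "leq alg (c p) (c q) \<longleftrightarrow> entails X p q"
  by (simp add: leq_def c_eq_iff equivalent_and_iff)

text \<open>Assignments into the Lindenbaum algebra are substitutions followed by the quotient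
  map.\<close>

lemma eval_alg: "eval alg (\<lambda>n. c (s n)) p = c (subst s p)"
  by (induction p) simp_all

text \<open>With elements written as classes, each law becomes an interderivability, an entailment
  or a derivability over \<open>X\<close>.\<close>

lemma V_algebra_alg: "V_algebra alg"
proof
  fix x y z assume "x \<in> carrier alg" "y \<in> carrier alg" "z \<in> carrier alg"
  then obtain p q r where [simp]: "x = c p" "y = c q" "z = c r"
    by auto
  show "x \<sqinter>\<^bsub>alg\<^esub> y \<sqinter>\<^bsub>alg\<^esub> z = x \<sqinter>\<^bsub>alg\<^esub> (y \<sqinter>\<^bsub>alg\<^esub> z)"
    by (simp add: c_eq_iff)
      (meson equivalentI entails_and1 entails_and2 entails_andI entails_trans)
  show "x \<squnion>\<^bsub>alg\<^esub> y \<squnion>\<^bsub>alg\<^esub> z = x \<squnion>\<^bsub>alg\<^esub> (y \<squnion>\<^bsub>alg\<^esub> z)"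
    by (simp add: c_eq_iff)
      (meson equivalentI entails_or1 entails_or2 entails_orI entails_trans)
  show "x \<sqinter>\<^bsub>alg\<^esub> (y \<squnion>\<^bsub>alg\<^esub> z) = (x \<sqinter>\<^bsub>alg\<^esub> y) \<squnion>\<^bsub>alg\<^esub> (x \<sqinter>\<^bsub>alg\<^esub> z)"
    by (simp add: c_eq_iff)
      (meson equivalentI entails_and_or entails_and1 entails_and2 entails_andI entails_or1
        entails_or2 entails_orI entails_trans)
  show "(x \<box>\<rightarrow>\<^bsub>alg\<^esub> y) \<sqinter>\<^bsub>alg\<^esub> (y \<box>\<rightarrow>\<^bsub>alg\<^esub> x) \<sqsubseteq>\<^bsub>alg\<^esub>
      ((x \<box>\<rightarrow>\<^bsub>alg\<^esub> z) \<leftrightarrow>\<^bsub>alg\<^esub> (y \<box>\<rightarrow>\<^bsub>alg\<^esub> z))"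
    by (simp add: L2 global_conditional)
  show "((x \<squnion>\<^bsub>alg\<^esub> y) \<box>\<rightarrow>\<^bsub>alg\<^esub> x) \<squnion>\<^bsub>alg\<^esub> ((x \<squnion>\<^bsub>alg\<^esub> y) \<box>\<rightarrow>\<^bsub>alg\<^esub> y) \<squnion>\<^bsub>alg\<^esub>
      (((x \<squnion>\<^bsub>alg\<^esub> y) \<box>\<rightarrow>\<^bsub>alg\<^esub> z) \<leftrightarrow>\<^bsub>alg\<^esub> (x \<box>\<rightarrow>\<^bsub>alg\<^esub> z) \<sqinter>\<^bsub>alg\<^esub> (y \<box>\<rightarrow>\<^bsub>alg\<^esub> z)) = \<one>\<^bsub>alg\<^esub>"
    by (simp add: c_eq_iff equivalent_top_iff L3 global_conditional)
  show "x \<box>\<rightarrow>\<^bsub>alg\<^esub> (y \<sqinter>\<^bsub>alg\<^esub> z) = (x \<box>\<rightarrow>\<^bsub>alg\<^esub> y) \<sqinter>\<^bsub>alg\<^esub> (x \<box>\<rightarrow>\<^bsub>alg\<^esub> z)"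
    by (simp add: c_eq_iff)
      (meson equivalentI L4 global_conditional entails_and1 entails_and2 global_mp)
next
  fix x y assume "x \<in> carrier alg" "y \<in> carrier alg"
  then obtain p q where [simp]: "x = c p" "y = c q"
    by auto
  show "x \<sqinter>\<^bsub>alg\<^esub> y \<in> carrier alg" "x \<squnion>\<^bsub>alg\<^esub> y \<in> carrier alg" "x \<rightarrow>\<^bsub>alg\<^esub> y \<in> carrier alg"
    "x \<box>\<rightarrow>\<^bsub>alg\<^esub> y \<in> carrier alg"
    by simp_all
  show "x \<sqinter>\<^bsub>alg\<^esub> y = y \<sqinter>\<^bsub>alg\<^esub> x"
    by (simp add: c_eq_iff equivalentI entails_and1 entails_and2 entails_andI)
  show "x \<squnion>\<^bsub>alg\<^esub> y = y \<squnion>\<^bsub>alg\<^esub> x"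
    by (simp add: c_eq_iff equivalentI entails_or1 entails_or2 entails_orI)
  show "x \<sqinter>\<^bsub>alg\<^esub> (x \<squnion>\<^bsub>alg\<^esub> y) = x"
    by (simp add: c_eq_iff equivalent_and_iff entails_or1)
  show "x \<squnion>\<^bsub>alg\<^esub> (x \<sqinter>\<^bsub>alg\<^esub> y) = x"
    by (simp add: c_eq_iff equivalentI entails_or1 entails_orI entails_refl entails_and1)
  show "x \<rightarrow>\<^bsub>alg\<^esub> y = (x \<rightarrow>\<^bsub>alg\<^esub> \<zero>\<^bsub>alg\<^esub>) \<squnion>\<^bsub>alg\<^esub> y"
    by (simp add: c_eq_iff equivalentI entails_material material_entails)
next
  fix x assume "x \<in> carrier alg"
  then obtain p where [simp]: "x = c p"
    by auto
  show "x \<squnion>\<^bsub>alg\<^esub> \<zero>\<^bsub>alg\<^esub> = x"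
    by (simp add: c_eq_iff equivalentI entails_or1 entails_orI entails_refl entails_bot)
  show "x \<sqinter>\<^bsub>alg\<^esub> \<one>\<^bsub>alg\<^esub> = x"
    by (simp add: c_eq_iff equivalent_and_iff entails_top)
  show "x \<sqinter>\<^bsub>alg\<^esub> (x \<rightarrow>\<^bsub>alg\<^esub> \<zero>\<^bsub>alg\<^esub>) = \<zero>\<^bsub>alg\<^esub>"
    by (simp add: c_eq_iff equivalentI entails_and_imp_bot entails_bot)
  show "x \<squnion>\<^bsub>alg\<^esub> (x \<rightarrow>\<^bsub>alg\<^esub> \<zero>\<^bsub>alg\<^esub>) = \<one>\<^bsub>alg\<^esub>"
    by (simp add: c_eq_iff equivalentI excluded_middle entails_top)
  show "x \<box>\<rightarrow>\<^bsub>alg\<^esub> x = \<one>\<^bsub>alg\<^esub>"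
    by (simp add: c_eq_iff equivalent_top_iff L1 global_conditional)
qed simp_all

end

lemma lindenbaum_exists:
  assumes "infinite (UNIV :: 'a set)"
  obtains c :: "fm \<Rightarrow> 'a" where "lindenbaum X c"
proof -
  obtain f :: "nat \<Rightarrow> 'a" where f: "inj f"
    using infinite_countable_subset[OF assms] by blast
  \<comment> \<open>Choose one formula per class, number it by countability of \<open>fm\<close>,
    and embed the number into the infinite type.\<close>
  define c where "c p = f (to_nat (SOME q. equivalent X p q))" for p
  have refl: "equivalent X p p" for p
    by (simp add: equivalentI entails_refl)
  have some: "equivalent X p (SOME q. equivalent X p q)" for p
    by (rule someI) (rule refl)
  have "c p = c q \<longleftrightarrow> equivalent X p q" for p q
  proof
    assume "c p = c q"
    then have "(SOME r. equivalent X p r) = (SOME r. equivalent X q r)"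
      using f by (simp add: c_def inj_eq)
    then show "equivalent X p q"
      using some[of p] some[of q] by (metis equivalent_def entails_trans)
  next
    assume "equivalent X p q"
    \<comment> \<open>Equality of the predicates themselves forces \<open>SOME\<close> to choose the
      same representative.\<close>
    then have "equivalent X p = equivalent X q"
      by (intro ext) (meson equivalent_def entails_trans)
    then show "c p = c q"
      by (simp add: c_def)
  qed
  then show thesis
    using that unfolding lindenbaum_def by blast
qed


section \<open>Completeness\<close>

text \<open>\<open>p\<close> acts as the conjunction of the set. Completeness uses both halves: the
  entailments discharge the additional axioms, and derivability from the set detaches
  \<open>p\<close> at the end.\<close>

lemma finite_conjunction:
  assumes "finite \<Delta>"
  obtains p where "local_der \<Delta> p" "\<And>q. q \<in> \<Delta> \<Longrightarrow> entails {} p q"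
  using assms
proof (induction arbitrary: thesis rule: finite_induct)
  case empty
  show ?case
    by (rule empty[of "\<^bold>1"]) (auto intro: local_theorem global_classical classical_axiom.intros)
next
  case (insert q \<Delta>)
  obtain p where p: "local_der \<Delta> p" "\<And>q. q \<in> \<Delta> \<Longrightarrow> entails {} p q"
    using insert.IH by blast
  show ?case
  proof (rule insert.prems)
    have "local_der (insert q \<Delta>) q" "local_der (insert q \<Delta>) p"
      using p(1) by (auto intro: local_premise local_der_mono)
    moreover have "local_der (insert q \<Delta>) (q \<^bold>\<rightarrow> p \<^bold>\<rightarrow> q \<^bold>\<and> p)"
      by (blast intro: local_theorem global_classical classical_axiom.intros)
    ultimately show "local_der (insert q \<Delta>) (q \<^bold>\<and> p)"
      by (blast intro: local_mp)
    show "entails {} (q \<^bold>\<and> p) r" if "r \<in> insert q \<Delta>" for r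
      using that p(2) by (blast intro: entails_and1 entails_and2 entails_trans)
  qed
qed

text \<open>The refuting algebra is a quotient of the countable set of formulas, so any infinite
  type has room for it.\<close>

lemma local_der_complete:
  assumes inf: "infinite (UNIV :: 'a set)"
    and deg: "degrees_of_truth (V_algebras :: 'a cond_algebra set) \<Gamma> p"
  shows "local_der \<Gamma> p"
proof -
  define shift where "shift = subst (\<lambda>n. Var (Suc n))"
  let ?ax = "\<lambda>q. Var 0 \<^bold>\<rightarrow> shift q"
  obtain c :: "fm \<Rightarrow> 'a" where "lindenbaum (?ax ` \<Gamma>) c"
    using lindenbaum_exists[OF inf] by blast
  then interpret lindenbaum "?ax ` \<Gamma>" c .
  \<comment> \<open>The class of \<open>Var 0\<close> is the degree being tested; the additional
    axioms place it below the value of every premise.\<close>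
  have "leq alg (c (Var 0)) (eval alg (\<lambda>n. c (Var (Suc n))) p)"
    using V_algebra_alg
    by (intro deg[unfolded degrees_of_truth_def V_algebras_def, rule_format])
      (auto simp: eval_alg shift_def[symmetric] intro: global_premise)
  then have "global_der (?ax ` \<Gamma>) (?ax p)"
    by (simp add: eval_alg shift_def)
  then obtain Y where "finite Y" "Y \<subseteq> ?ax ` \<Gamma>" and Y: "global_der Y (?ax p)"
    using global_der_finite by blast
  then obtain \<Delta> where \<Delta>: "finite \<Delta>" "\<Delta> \<subseteq> \<Gamma>" "Y = ?ax ` \<Delta>"
    by (meson finite_subset_image)
  obtain d where d: "local_der \<Delta> d" "\<And>q. q \<in> \<Delta> \<Longrightarrow> entails {} d q"
    using finite_conjunction[OF \<Delta>(1)] by blast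
  \<comment> \<open>\<open>Var 0\<close> becomes \<open>d\<close> and \<open>Var (Suc n)\<close>
    becomes \<open>Var n\<close>, so the axiom for \<open>q\<close> turns into the implication from
    \<open>d\<close> to \<open>q\<close>, a theorem for \<open>q\<close> in
    \<open>\<Delta>\<close>.\<close>
  define unshift where "unshift = case_nat d Var"
  have unshift: "subst unshift (shift q) = q" for q
    by (induction q) (simp_all add: shift_def unshift_def)
  have "global_der {} (subst unshift (?ax p))"
    by (rule global_der_subst[OF Y]) (auto simp: \<Delta>(3) unshift unshift_def[THEN fun_cong] d(2))
  then have "entails {} d p"
    by (simp add: unshift) (simp add: unshift_def)
  then have "local_der \<Delta> p"
    using d(1) by (blast intro: local_mp local_theorem)
  then show ?thesis
    using \<Delta>(2) by (rule local_der_mono)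
qed

theorem theorem4p15:
  assumes "infinite (UNIV :: 'a set)"
  shows "LV = degrees_of_truth (V_algebras :: 'a cond_algebra set)"
proof (intro ext iffI)
  fix \<Gamma> p
  show "degrees_of_truth (V_algebras :: 'a cond_algebra set) \<Gamma> p" if "LV \<Gamma> p"
    unfolding degrees_of_truth_def V_algebras_def
    using that by (auto simp: LV_eq_local_der intro: V_algebra.local_der_sound)
  show "LV \<Gamma> p" if "degrees_of_truth (V_algebras :: 'a cond_algebra set) \<Gamma> p"
    using local_der_complete[OF assms that] by (simp add: LV_eq_local_der)
qed

end
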